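(* Let $G$ be a finite connected graph with vertices $v_1,\dots,v_n$, let $w:D(G)\to\mathbb{C}$ be a symmetric weight function, and let ${\bf W}$ be the weighted matrix of $G$ corresponding to $w$. Let \[ f_w(u,t)=\det\big({\bf I}_n-t{\bf W}+(1-u)t^2({\bf D}_w-(1-u){\bf I}_n)\big). \] Then for every nonzero complex number $t$, \[ \frac{\partial f_w(u,t)}{\partial t}\Big|_{(u,t)=(1-1/t,\,t)}=2t^{n-2}(w(G)t-n)\,\kappa_w(G), \qquad \frac{\partial f_w(u,t)}{\partial u}\Big|_{(u,t)=(1-1/t,\,t)}=-2t^{n}(w(G)t-n)\,\kappa_w(G). \]
   Context: $D(G)=\{(u,v),(v,u): uv\in E(G)\}$ is the set of arcs of the symmetric digraph of $G$; for an arc $e=(u,v)$, $o(e)=u$, $e^{-1}=(v,u)$. A weight function $w:D(G)\to\mathbb{C}$ is symmetric if $w(e^{-1})=w(e)$ for all $e$; it is then regarded as a function on $E(G)$. The weighted matrix ${\bf W}=(w_{ij})$ is the $n\times n$ matrix with $w_{ij}=w(v_i,v_j)$ if $(v_i,v_j)\in D(G)$ and $w_{ij}=0$ otherwise. ${\bf D}_w$ is the diagonal matrix with $i$-th diagonal entry $d^w_i=\sum_{o(e)=v_i}w(e)$. $w(G)=\sum_{uv\in E(G)}w(u,v)$. The weighted complexity is $\kappa_w(G)=\sum_T\prod_{e\in E(T)}w(e)$, the sum over all spanning trees $T$ of $G$. The notation $|_{(1-1/t,t)}$ means the partial derivative is evaluated at the point $u=1-1/t$ with the same value of $t$. *)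

theory Defs
  imports Complex_Main "Jordan_Normal_Form.Determinant" "Graph_Theory.Graph_Theory"
begin

text \<open>
  A finite simple graph is represented by its symmetric digraph: \<open>pair_graph G\<close> says that
  \<open>G\<close> has finitely many vertices, no loops, and an arc set \<open>parcs G\<close> that is closed under
  reversal, so \<open>parcs G\<close> is the set of arcs \<open>D(G)\<close>.  An undirected edge is the two-element
  set of its end points.
\<close>

definition edges_of :: "'a pair_pre_digraph \<Rightarrow> 'a set set" where
  "edges_of G = (\<lambda>(u, v). {u, v}) ` parcs G"

definition symmetric_weight :: "'a pair_pre_digraph \<Rightarrow> ('a \<times> 'a \<Rightarrow> complex) \<Rightarrow> bool" where
  "symmetric_weight G w \<longleftrightarrow> (\<forall>(u, v) \<in> parcs G. w (v, u) = w (u, v))"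

text \<open>The symmetric weight \<open>w\<close>, regarded as a function on edges.\<close>

definition edge_weight ::
    "'a pair_pre_digraph \<Rightarrow> ('a \<times> 'a \<Rightarrow> complex) \<Rightarrow> 'a set \<Rightarrow> complex" where
  "edge_weight G w e = (THE c. \<exists>u v. (u, v) \<in> parcs G \<and> e = {u, v} \<and> c = w (u, v))"

lemma edge_weight_eq:
  assumes "symmetric_weight G w" "(u, v) \<in> parcs G"
  shows "edge_weight G w {u, v} = w (u, v)"
  unfolding edge_weight_def
proof (rule the_equality)
  show "\<exists>u' v'. (u', v') \<in> parcs G \<and> {u, v} = {u', v'} \<and> w (u, v) = w (u', v')"
    using assms(2) by blast
next
  fix c
  assume "\<exists>u' v'. (u', v') \<in> parcs G \<and> {u, v} = {u', v'} \<and> c = w (u', v')"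
  then show "c = w (u, v)"
    using assms unfolding symmetric_weight_def by (auto simp: doubleton_eq_iff)
qed

definition total_weight :: "'a pair_pre_digraph \<Rightarrow> ('a \<times> 'a \<Rightarrow> complex) \<Rightarrow> complex" where
  "total_weight G w = (\<Sum>e\<in>edges_of G. edge_weight G w e)"

text \<open>
  The library's \<open>tree\<close> and \<open>spanning_tree\<close> forbid directed cycles, including the closed walk
  \<open>u, v, u\<close> along an edge and its reverse, so they do not describe undirected trees.  In the
  symmetric digraph of a simple graph the undirected cycles are the cycles of length at least 3.
\<close>

definition undirected_tree :: "'a pair_pre_digraph \<Rightarrow> bool" where
  "undirected_tree T \<longleftrightarrow> pair_graph T \<and> Digraph_Component.connected (with_proj T) \<and>
     \<not> (\<exists>p. pre_digraph.cycle (with_proj T) p \<and> 3 \<le> length p)"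

definition spanning_trees :: "'a pair_pre_digraph \<Rightarrow> 'a pair_pre_digraph set" where
  "spanning_trees G = {T. undirected_tree T \<and> spanning (with_proj T) (with_proj G)}"

lemma finite_spanning_trees:
  assumes "pair_graph G"
  shows "finite (spanning_trees G)"
proof -
  interpret pair_graph G by fact
  have "spanning_trees G \<subseteq>
      (\<lambda>A. \<lparr>pverts = pverts G, parcs = A\<rparr>) ` Pow (parcs G)"
  proof
    fix T assume "T \<in> spanning_trees G"
    then have "pverts T = pverts G" "parcs T \<subseteq> parcs G"
      by (auto simp: spanning_trees_def spanning_def subgraph_def)
    then show "T \<in> (\<lambda>A. \<lparr>pverts = pverts G, parcs = A\<rparr>) ` Pow (parcs G)"
      by (intro image_eqI[of _ _ "parcs T"]) auto
  qed
  then show ?thesis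
    using pair_finite_arcs by (meson finite_Pow_iff finite_imageI finite_subset)
qed

definition weighted_complexity ::
    "'a pair_pre_digraph \<Rightarrow> ('a \<times> 'a \<Rightarrow> complex) \<Rightarrow> complex" where
  "weighted_complexity G w = (\<Sum>T\<in>spanning_trees G. \<Prod>e\<in>edges_of T. edge_weight G w e)"

text \<open>
  The list \<open>vs\<close> enumerates the vertices; indices start at 0.
\<close>

definition weighted_matrix ::
    "'a pair_pre_digraph \<Rightarrow> 'a list \<Rightarrow> ('a \<times> 'a \<Rightarrow> complex) \<Rightarrow> complex mat" where
  "weighted_matrix G vs w = mat (length vs) (length vs)
     (\<lambda>(i, j). if (vs ! i, vs ! j) \<in> parcs G then w (vs ! i, vs ! j) else 0)"

definition weighted_degree_matrix ::
    "'a pair_pre_digraph \<Rightarrow> 'a list \<Rightarrow> ('a \<times> 'a \<Rightarrow> complex) \<Rightarrow> complex mat" where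
  "weighted_degree_matrix G vs w = mat (length vs) (length vs)
     (\<lambda>(i, j). if i = j then (\<Sum>e\<in>out_arcs (with_proj G) (vs ! i). w e) else 0)"

definition f_w ::
    "'a pair_pre_digraph \<Rightarrow> 'a list \<Rightarrow> ('a \<times> 'a \<Rightarrow> complex) \<Rightarrow> complex \<Rightarrow> complex \<Rightarrow> complex" where
  "f_w G vs w u t = det (1\<^sub>m (length vs) - t \<cdot>\<^sub>m weighted_matrix G vs w
     + ((1 - u) * t\<^sup>2) \<cdot>\<^sub>m (weighted_degree_matrix G vs w - (1 - u) \<cdot>\<^sub>m 1\<^sub>m (length vs)))"

end

theory Submission
  imports Defs
begin

text \<open>
  At \<open>u = 1 - 1/t\<close> the matrix is \<open>t L\<close> with \<open>L = D - W\<close> the weighted Laplacian.  The derivative of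
  the determinant is the sum over \<open>k\<close> of the determinants in which row \<open>k\<close> of \<open>t L\<close> is replaced by
  row \<open>k\<close> of the differentiated matrix.  As all rows of \<open>L\<close> sum to zero, such a determinant depends
  on the new row only through the sum of its entries, so it is this sum times the determinant with
  the unit vector \<open>e\<^sub>k\<close> as row \<open>k\<close>, and the latter is \<open>t\<^bsup>n-1\<^esup> \<kappa>\<^sub>w(G)\<close> by the matrix-tree theorem.

  For the matrix-tree theorem, write row \<open>i \<noteq> k\<close> of \<open>L\<close> as the sum of \<open>w\<^sub>i\<^sub>j (e\<^sub>i - e\<^sub>j)\<close> over \<open>j\<close> and
  expand by multilinearity into a sum over parent maps \<open>\<phi>\<close>.  The determinant with rows
  \<open>e\<^sub>i - e\<^bsub>\<phi>(i)\<^esub>\<close> is 1 if every vertex reaches \<open>k\<close> under iteration of \<open>\<phi>\<close> and 0 otherwise, and the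
  maps of the first kind are exactly the spanning trees oriented towards \<open>k\<close>.
\<close>

section \<open>Determinants\<close>

lemma det_mat:
  "det (mat n n (\<lambda>(i, j). A i j)) =
     (\<Sum>p\<in>{p. p permutes {0..<n}}. signof p * (\<Prod>i\<in>{0..<n}. A i (p i)))"
proof -
  have "det (mat n n (\<lambda>(i, j). A i j)) =
     (\<Sum>p\<in>{p. p permutes {0..<n}}.
        signof p * (\<Prod>i\<in>{0..<n}. mat n n (\<lambda>(i, j). A i j) $$ (i, p i)))"
    by (rule det_def') simp
  also have "\<dots> = (\<Sum>p\<in>{p. p permutes {0..<n}}. signof p * (\<Prod>i\<in>{0..<n}. A i (p i)))"
  proof (intro sum.cong refl arg_cong2[where f = "(*)"] prod.cong)
    fix p i assume "p \<in> {p. p permutes {0..<n}}" "i \<in> {0..<n}"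
    moreover from this have "p i < n" using permutes_in_image[of p "{0..<n}" i] by simp
    ultimately show "mat n n (\<lambda>(i, j). A i j) $$ (i, p i) = A i (p i)" by simp
  qed
  finally show ?thesis .
qed

text \<open>Splitting the factor of row \<open>k\<close> off every Leibniz product exhibits the
  linearity in that row.\<close>

lemma det_mat_replace_row:
  assumes "k < n"
  shows "det (mat n n (\<lambda>(i, j). if i = k then v j else A i j)) =
     (\<Sum>p\<in>{p. p permutes {0..<n}}. signof p * (v (p k) * (\<Prod>i\<in>{0..<n} - {k}. A i (p i))))"
proof -
  have "(\<Prod>i\<in>{0..<n}. if i = k then v (p i) else A i (p i)) =
      v (p k) * (\<Prod>i\<in>{0..<n} - {k}. A i (p i))" for p
    using assms by (subst prod.remove[of _ k]) (auto intro!: prod.cong)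
  then show ?thesis by (simp add: det_mat)
qed

text \<open>Multilinearity in all rows at once: a product of sums becomes a sum over choice
  functions \<open>\<phi>\<close>, and exchanging the sums leaves one determinant per
  choice.\<close>

lemma det_mat_sum_rows:
  assumes "\<And>i. i < n \<Longrightarrow> finite (S i)"
  shows "det (mat n n (\<lambda>(i, l). \<Sum>j\<in>S i. c i j * g i j l)) =
     (\<Sum>\<phi>\<in>(\<Pi>\<^sub>E i\<in>{0..<n}. S i).
        (\<Prod>i\<in>{0..<n}. c i (\<phi> i)) * det (mat n n (\<lambda>(i, l). g i (\<phi> i) l)))"
proof -
  have "det (mat n n (\<lambda>(i, l). \<Sum>j\<in>S i. c i j * g i j l)) =
     (\<Sum>p\<in>{p. p permutes {0..<n}}. \<Sum>\<phi>\<in>(\<Pi>\<^sub>E i\<in>{0..<n}. S i).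
        signof p * (\<Prod>i\<in>{0..<n}. c i (\<phi> i) * g i (\<phi> i) (p i)))"
    unfolding det_mat sum_distrib_left[symmetric]
    by (intro sum.cong refl arg_cong2[where f = "(*)"] prod_sum_PiE) (use assms in auto)
  also have "\<dots> = (\<Sum>\<phi>\<in>(\<Pi>\<^sub>E i\<in>{0..<n}. S i). \<Sum>p\<in>{p. p permutes {0..<n}}.
        signof p * (\<Prod>i\<in>{0..<n}. c i (\<phi> i) * g i (\<phi> i) (p i)))"
    by (rule sum.swap)
  also have "\<dots> = (\<Sum>\<phi>\<in>(\<Pi>\<^sub>E i\<in>{0..<n}. S i).
        (\<Prod>i\<in>{0..<n}. c i (\<phi> i)) * det (mat n n (\<lambda>(i, l). g i (\<phi> i) l)))"
    by (simp add: det_mat prod.distrib sum_distrib_left mult.left_commute)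
  finally show ?thesis .
qed

lemma det_mat_eq_0_if_kernel:
  fixes A :: "nat \<Rightarrow> nat \<Rightarrow> 'c :: idom"
  assumes "\<And>i. i < n \<Longrightarrow> (\<Sum>j\<in>{0..<n}. A i j * x j) = 0" and "k < n" "x k \<noteq> 0"
  shows "det (mat n n (\<lambda>(i, j). A i j)) = 0"
proof -
  have "vec n x \<noteq> 0\<^sub>v n"
    using assms(2,3) by (metis index_vec index_zero_vec(1))
  moreover have "mat n n (\<lambda>(i, j). A i j) *\<^sub>v vec n x = 0\<^sub>v n"
    using assms(1) by (intro eq_vecI) (auto simp: scalar_prod_def)
  ultimately show ?thesis
    using det_0_iff_vec_prod_zero[of "mat n n (\<lambda>(i, j). A i j)" n]
      vec_carrier mat_carrier by blast
qed

text \<open>With \<open>s\<close> the sum of \<open>v\<close>, the row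
  \<open>v j - s * of_bool (j = k)\<close> sums to zero. Put in as row \<open>k\<close>, it makes
  the all-ones vector a kernel vector, and linearity in row \<open>k\<close> gives the
  claim.\<close>

lemma det_mat_replace_row_zero_row_sums:
  fixes A :: "nat \<Rightarrow> nat \<Rightarrow> 'c :: idom"
  assumes k: "k < n"
    and A: "\<And>i. i < n \<Longrightarrow> i \<noteq> k \<Longrightarrow> (\<Sum>j\<in>{0..<n}. A i j) = 0"
  shows "det (mat n n (\<lambda>(i, j). if i = k then v j else A i j)) =
     (\<Sum>j\<in>{0..<n}. v j) * det (mat n n (\<lambda>(i, j). if i = k then of_bool (j = k) else A i j))"
proof -
  define s where "s = (\<Sum>j\<in>{0..<n}. v j)"
  have "det (mat n n (\<lambda>(i, j). if i = k then v j - s * of_bool (j = k) else A i j)) = 0"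
  proof (rule det_mat_eq_0_if_kernel[where x = "\<lambda>_. 1" and k = k])
    fix i assume "i < n"
    show "(\<Sum>j\<in>{0..<n}. (if i = k then v j - s * of_bool (j = k) else A i j) * 1) = 0"
    proof (cases "i = k")
      case True
      have "(\<Sum>j\<in>{0..<n}. s * of_bool (j = k)) = s"
        using k by (simp add: of_bool_def if_distrib cong: if_cong)
      with True show ?thesis by (simp add: sum_subtractf s_def)
    qed (use A \<open>i < n\<close> in simp)
  qed (use k in auto)
  then show ?thesis
    unfolding det_mat_replace_row[OF k] s_def[symmetric]
    by (simp add: left_diff_distrib right_diff_distrib sum_subtractf sum_distrib_left mult_ac)
qed

text \<open>Product rule in each Leibniz product; swapping the sums over \<open>p\<close> and
  \<open>k\<close> collects the terms in which row \<open>k\<close> is differentiated.\<close>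

lemma has_field_derivative_det_mat:
  fixes A :: "'c :: real_normed_field \<Rightarrow> nat \<Rightarrow> nat \<Rightarrow> 'c"
  assumes "\<And>i j. i < n \<Longrightarrow> j < n \<Longrightarrow> ((\<lambda>s. A s i j) has_field_derivative A' i j) (at z)"
  shows "((\<lambda>s. det (mat n n (\<lambda>(i, j). A s i j))) has_field_derivative
     (\<Sum>k\<in>{0..<n}. det (mat n n (\<lambda>(i, j). if i = k then A' i j else A z i j)))) (at z)"
proof -
  have "((\<lambda>s. \<Sum>p\<in>{p. p permutes {0..<n}}. signof p * (\<Prod>i\<in>{0..<n}. A s i (p i)))
      has_field_derivative
     (\<Sum>p\<in>{p. p permutes {0..<n}}. signof p *
       (\<Sum>k\<in>{0..<n}. A' k (p k) * (\<Prod>i\<in>{0..<n} - {k}. A z i (p i))))) (at z)"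
  proof (intro DERIV_sum DERIV_cmult has_field_derivative_prod)
    fix p i assume "p \<in> {p. p permutes {0..<n}}" "i \<in> {0..<n}"
    moreover from this have "p i < n" using permutes_in_image[of p "{0..<n}" i] by simp
    ultimately show "((\<lambda>s. A s i (p i)) has_field_derivative A' i (p i)) (at z)"
      using assms by simp
  qed
  moreover have "(\<Sum>p\<in>{p. p permutes {0..<n}}. signof p *
       (\<Sum>k\<in>{0..<n}. A' k (p k) * (\<Prod>i\<in>{0..<n} - {k}. A z i (p i)))) =
     (\<Sum>k\<in>{0..<n}. det (mat n n (\<lambda>(i, j). if i = k then A' k j else A z i j)))"
    by (simp add: det_mat_replace_row sum_distrib_left sum.swap[of _ "{0..<n}"])
  moreover have "(\<lambda>(i, j). if i = k then A' k j else A z i j) =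
      (\<lambda>(i, j). if i = k then A' i j else A z i j)" for k
    by auto
  ultimately show ?thesis by (simp add: det_mat)
qed

section \<open>Parent maps and the rooted matrix-tree theorem\<close>

lemma funpow_fixpoint: "f x = x \<Longrightarrow> (f ^^ m) x = x"
  by (induction m) auto

text \<open>If every index reaches \<open>r\<close>, a permutation with nonzero contribution maps each \<open>i\<close> to \<open>i\<close> or
  \<open>\<phi> i\<close>; once it moves \<open>i\<close> it moves every iterate of \<open>i\<close>, hence \<open>r\<close>, which is impossible.
  Otherwise the indicator function of the indices that do not reach \<open>r\<close> is in the kernel.\<close>

lemma det_parent_matrix:
  assumes r: "r < n" and \<phi>: "\<And>i. i < n \<Longrightarrow> \<phi> i < n" and \<phi>r: "\<phi> r = r"
  shows "det (mat n n (\<lambda>(i, l). of_bool (l = i) - of_bool (i \<noteq> r \<and> l = \<phi> i))) =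
    (of_bool (\<forall>i<n. \<exists>m. (\<phi> ^^ m) i = r) :: 'c :: idom)"
proof (cases "\<forall>i<n. \<exists>m. (\<phi> ^^ m) i = r")
  case True
  let ?N = "\<lambda>i l. of_bool (l = i) - of_bool (i \<noteq> r \<and> l = \<phi> i) :: 'c"
  have "(\<Prod>i\<in>{0..<n}. ?N i (p i)) = 0" if p: "p permutes {0..<n}" "p \<noteq> id" for p
  proof (rule ccontr)
    assume "\<not> ?thesis"
    then have nz: "?N i (p i) \<noteq> 0" if "i < n" for i
      using that by auto
    have move: "p i = i \<or> i \<noteq> r \<and> p i = \<phi> i" if "i < n" for i
      using nz[OF that] by (auto split: if_splits)
    obtain i where i: "i < n" "p i \<noteq> i"
      using p by (metis atLeast0LessThan eq_id_iff lessThan_iff permutes_not_in)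
    have "(\<phi> ^^ m) i < n \<and> p ((\<phi> ^^ m) i) \<noteq> (\<phi> ^^ m) i" for m
    proof (induction m)
      case (Suc m)
      then have *: "p ((\<phi> ^^ m) i) = (\<phi> ^^ Suc m) i" using move by auto
      moreover have "p (p ((\<phi> ^^ m) i)) \<noteq> p ((\<phi> ^^ m) i)"
        using Suc permutes_inj[OF p(1)] by (metis injD)
      ultimately show ?case using Suc \<phi> by auto
    qed (use i in simp)
    moreover obtain m where "(\<phi> ^^ m) i = r" using True i by auto
    ultimately show False using move[OF r] by metis
  qed
  then have "(\<Sum>p\<in>{p. p permutes {0..<n}}. signof p * (\<Prod>i\<in>{0..<n}. ?N i (p i))) =
      (\<Sum>p\<in>{id}. signof p * (\<Prod>i\<in>{0..<n}. ?N i (p i)))"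
    by (intro sum.mono_neutral_right) (auto simp: permutes_id finite_permutations)
  also have "\<dots> = 1"
  proof -
    \<comment> \<open>A fixed point of \<open>\<phi>\<close> other than \<open>r\<close> never
      reaches \<open>r\<close>, so all diagonal entries are 1.\<close>
    have "\<not> (i \<noteq> r \<and> i = \<phi> i)" if "i < n" for i
      using True that funpow_fixpoint[of \<phi> i] by metis
    then show ?thesis by (auto intro!: prod.neutral)
  qed
  finally show ?thesis using True by (simp add: det_mat)
next
  case False
  define x where "x i = (of_bool (\<nexists>m. (\<phi> ^^ m) i = r) :: 'c)" for i
  obtain k where k: "k < n" "x k \<noteq> 0" using False by (auto simp: x_def)
  \<comment> \<open>Away from \<open>r\<close>, a point and its parent reach \<open>r\<close> or
    fail to together. Row \<open>i\<close> computes \<open>x i - x (\<phi> i)\<close> and so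
    annihilates \<open>x\<close>; row \<open>r\<close> does because \<open>x r = 0\<close>.\<close>
  have step: "x (\<phi> i) = x i" if "i \<noteq> r" for i
  proof -
    have "(\<exists>m. (\<phi> ^^ m) (\<phi> i) = r) \<longleftrightarrow> (\<exists>m. (\<phi> ^^ m) i = r)"
    proof
      assume "\<exists>m. (\<phi> ^^ m) (\<phi> i) = r"
      then obtain m where "(\<phi> ^^ Suc m) i = r" by (auto simp: funpow_swap1)
      then show "\<exists>m. (\<phi> ^^ m) i = r" by blast
    next
      assume "\<exists>m. (\<phi> ^^ m) i = r"
      then obtain m where "(\<phi> ^^ m) i = r" by blast
      with that show "\<exists>m. (\<phi> ^^ m) (\<phi> i) = r"
        by (cases m) (auto simp: funpow_swap1)
    qed
    then show ?thesis by (simp add: x_def)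
  qed
  have xr: "x r = 0" unfolding x_def by (auto intro: exI[of _ 0])
  have "det (mat n n (\<lambda>(i, l). of_bool (l = i) - of_bool (i \<noteq> r \<and> l = \<phi> i) :: 'c)) = 0"
  proof (rule det_mat_eq_0_if_kernel[where x = x, OF _ k])
    fix i assume i: "i < n"
    have "(\<Sum>j\<in>{0..<n}. (of_bool (j = i) - of_bool (i \<noteq> r \<and> j = \<phi> i)) * x j) =
       (\<Sum>j\<in>{0..<n}. if j = i then x j else 0) -
       (\<Sum>j\<in>{0..<n}. if j = \<phi> i then of_bool (i \<noteq> r) * x j else 0)"
      unfolding sum_subtractf[symmetric] by (rule sum.cong) (auto simp: of_bool_def)
    also have "\<dots> = x i - of_bool (i \<noteq> r) * x (\<phi> i)"
      using i \<phi> by simp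
    also have "\<dots> = 0" using step xr by (cases "i = r") auto
    finally show "(\<Sum>j\<in>{0..<n}. (of_bool (j = i) - of_bool (i \<noteq> r \<and> j = \<phi> i)) * x j) = 0" .
  qed
  with False show ?thesis by simp
qed

text \<open>A rooted tree on \<open>V\<close>, encoded by its parent map. The root is its own
  parent, so iteration stays there, and extensionality fixes the values outside
  \<open>V\<close>.\<close>

definition rooted_maps :: "'a set \<Rightarrow> 'a \<Rightarrow> ('a \<Rightarrow> 'a) set" where
  "rooted_maps V r = {\<phi> \<in> V \<rightarrow>\<^sub>E V. \<phi> r = r \<and> (\<forall>x\<in>V. \<exists>m. (\<phi> ^^ m) x = r)}"

text \<open>Directed matrix-tree theorem. The loop coefficients \<open>a i i\<close> cancel on the
  diagonal, just as rooted maps have no fixed point besides \<open>r\<close>.\<close>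

theorem det_laplacian_rooted:
  fixes a :: "nat \<Rightarrow> nat \<Rightarrow> 'c :: idom"
  assumes r: "r < n"
  shows "det (mat n n (\<lambda>(i, l). if i = r then of_bool (l = r)
       else of_bool (l = i) * (\<Sum>j\<in>{0..<n}. a i j) - a i l)) =
     (\<Sum>\<phi>\<in>rooted_maps {0..<n} r. \<Prod>i\<in>{0..<n} - {r}. a i (\<phi> i))"
proof -
  \<comment> \<open>In row \<open>r\<close> the single choice \<open>r\<close> with coefficient 1
    reproduces the unit vector and forces \<open>\<phi> r = r\<close>.\<close>
  define S where "S i = (if i = r then {r} else {0..<n})" for i
  define c where "c i j = (if i = r then 1 else a i j)" for i j
  define g where "g i j l = (of_bool (l = i) - of_bool (i \<noteq> r \<and> l = j) :: 'c)" for i j l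
  have PiE_S: "(\<Pi>\<^sub>E i\<in>{0..<n}. S i) = {\<phi> \<in> {0..<n} \<rightarrow>\<^sub>E {0..<n}. \<phi> r = r}"
  proof (rule Set.set_eqI)
    fix \<phi>
    have "(\<forall>i<n. \<phi> i \<in> S i) \<longleftrightarrow> (\<forall>i<n. \<phi> i < n) \<and> \<phi> r = r"
      using r unfolding S_def by (metis atLeastLessThan_iff singleton_iff zero_le)
    then show "\<phi> \<in> (\<Pi>\<^sub>E i\<in>{0..<n}. S i) \<longleftrightarrow> \<phi> \<in> {\<phi> \<in> {0..<n} \<rightarrow>\<^sub>E {0..<n}. \<phi> r = r}"
      by (simp add: PiE_iff Ball_def) blast
  qed
  have entry: "(if i = r then of_bool (l = r)
       else of_bool (l = i) * (\<Sum>j\<in>{0..<n}. a i j) - a i l) = (\<Sum>j\<in>S i. c i j * g i j l)"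
    if "l < n" for i l
  proof (cases "i = r")
    case False
    have "(\<Sum>j\<in>S i. c i j * g i j l) =
       (\<Sum>j\<in>{0..<n}. of_bool (l = i) * a i j) - (\<Sum>j\<in>{0..<n}. if j = l then a i j else 0)"
      unfolding sum_subtractf[symmetric]
      by (rule sum.cong) (use False in \<open>auto simp: S_def c_def g_def of_bool_def\<close>)
    with False that show ?thesis by (simp add: sum_distrib_left)
  qed (simp add: S_def c_def g_def)
  have "mat n n (\<lambda>(i, l). if i = r then of_bool (l = r)
       else of_bool (l = i) * (\<Sum>j\<in>{0..<n}. a i j) - a i l) =
     mat n n (\<lambda>(i, l). \<Sum>j\<in>S i. c i j * g i j l)"
    by (intro eq_matI) (use entry in auto)
  then have "det (mat n n (\<lambda>(i, l). if i = r then of_bool (l = r)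
       else of_bool (l = i) * (\<Sum>j\<in>{0..<n}. a i j) - a i l)) =
     (\<Sum>\<phi>\<in>(\<Pi>\<^sub>E i\<in>{0..<n}. S i).
        (\<Prod>i\<in>{0..<n}. c i (\<phi> i)) * det (mat n n (\<lambda>(i, l). g i (\<phi> i) l)))"
    by (simp add: det_mat_sum_rows S_def)
  also have "\<dots> = (\<Sum>\<phi>\<in>{\<phi> \<in> {0..<n} \<rightarrow>\<^sub>E {0..<n}. \<phi> r = r}.
        (\<Prod>i\<in>{0..<n} - {r}. a i (\<phi> i)) * of_bool (\<forall>i<n. \<exists>m. (\<phi> ^^ m) i = r))"
    unfolding PiE_S
  proof (intro sum.cong refl arg_cong2[where f = "(*)"])
    fix \<phi> assume \<phi>: "\<phi> \<in> {\<phi> \<in> {0..<n} \<rightarrow>\<^sub>E {0..<n}. \<phi> r = r}"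
    show "(\<Prod>i\<in>{0..<n}. c i (\<phi> i)) = (\<Prod>i\<in>{0..<n} - {r}. a i (\<phi> i))"
      using r by (subst prod.remove[of _ r]) (auto simp: c_def intro!: prod.cong)
    have "\<phi> i < n" if "i < n" for i
      using \<phi> that by (auto simp: PiE_iff)
    then show "det (mat n n (\<lambda>(i, l). g i (\<phi> i) l)) = of_bool (\<forall>i<n. \<exists>m. (\<phi> ^^ m) i = r)"
      using \<phi> r unfolding g_def by (intro det_parent_matrix) auto
  qed
  also have "\<dots> = (\<Sum>\<phi>\<in>rooted_maps {0..<n} r. \<Prod>i\<in>{0..<n} - {r}. a i (\<phi> i))"
  proof (rule sum.mono_neutral_cong_right)
    show "finite {\<phi> \<in> {0..<n} \<rightarrow>\<^sub>E {0..<n}. \<phi> r = r}"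
      by (rule finite_subset[of _ "{0..<n} \<rightarrow>\<^sub>E {0..<n}"]) (auto intro: finite_PiE)
  qed (auto simp: rooted_maps_def)
  finally show ?thesis .
qed

section \<open>Rooted maps and spanning trees\<close>

lemma rooted_mapsD:
  assumes "\<phi> \<in> rooted_maps V r"
  shows "\<And>x. x \<in> V \<Longrightarrow> \<phi> x \<in> V" "\<phi> r = r" "\<And>x. x \<in> V \<Longrightarrow> \<exists>m. (\<phi> ^^ m) x = r"
    "\<phi> \<in> extensional V"
  using assms by (auto simp: rooted_maps_def PiE_iff)

text \<open>If \<open>r\<close> is reached after \<open>k\<close> steps, then \<open>k * m\<close>
  is a multiple of the period and at least \<open>k\<close>. As \<open>r\<close> is absorbing, the
  iterate \<open>k * m\<close> is both \<open>x\<close> and \<open>r\<close>.\<close>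

lemma rooted_maps_periodic:
  assumes \<phi>: "\<phi> \<in> rooted_maps V r" and x: "x \<in> V" and "(\<phi> ^^ m) x = x" "m > 0"
  shows "x = r"
proof -
  obtain k where k: "(\<phi> ^^ k) x = r" using rooted_mapsD(3)[OF \<phi> x] by blast
  have "(\<phi> ^^ (k * m)) x = x"
    using funpow_fixpoint[of "\<phi> ^^ m" x k] assms(3) by (simp add: funpow_mult mult.commute)
  moreover have "k * m = (k * m - k) + k" using \<open>m > 0\<close> by simp
  ultimately have "x = (\<phi> ^^ (k * m - k)) ((\<phi> ^^ k) x)" by (metis comp_apply funpow_add)
  then show ?thesis using k funpow_fixpoint[of \<phi> r] rooted_mapsD(2)[OF \<phi>] by simp
qed

text \<open>Excluding period one rules out loops in the tree; excluding period two makes an edge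
  determine which of its ends is the child.\<close>

lemma rooted_maps_no_swap:
  assumes "\<phi> \<in> rooted_maps V r" "x \<in> V" "x \<noteq> r"
  shows "\<phi> x \<noteq> x" "\<phi> (\<phi> x) \<noteq> x"
  using rooted_maps_periodic[OF assms(1,2), of 1] rooted_maps_periodic[OF assms(1,2), of 2]
    assms(3) by (auto simp: numeral_2_eq_2)

text \<open>Carries the determinant formula from matrix indices to vertices by conjugating with
  \<open>h\<close>, which commutes with iteration; restriction keeps the conjugates
  extensional.\<close>

lemma sum_rooted_maps_reindex:
  assumes h: "bij_betw h I V" and r: "r \<in> I"
  shows "(\<Sum>\<phi>\<in>rooted_maps I r. \<Prod>i\<in>I - {r}. a (h i) (h (\<phi> i))) =
    (\<Sum>\<psi>\<in>rooted_maps V (h r). \<Prod>x\<in>V - {h r}. a x (\<psi> x))"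
proof -
  define g where "g = inv_into I h"
  have gh: "g (h i) = i" if "i \<in> I" for i
    using h that by (simp add: g_def bij_betw_def inv_into_f_f)
  have hg: "h (g x) = x" "g x \<in> I" if "x \<in> V" for x
    using h that by (auto simp: g_def bij_betw_def f_inv_into_f inv_into_into)
  have hV: "h i \<in> V" if "i \<in> I" for i using h that by (auto simp: bij_betw_def)
  define F where "F \<phi> = restrict (\<lambda>x. h (\<phi> (g x))) V" for \<phi>
  define F' where "F' \<psi> = restrict (\<lambda>i. g (\<psi> (h i))) I" for \<psi>
  have pow: "(F \<phi> ^^ m) (h i) = h ((\<phi> ^^ m) i) \<and> (\<phi> ^^ m) i \<in> I"
    if "\<phi> \<in> rooted_maps I r" "i \<in> I" for \<phi> m i
    using rooted_mapsD[OF that(1)] that(2) by (induction m) (auto simp: F_def hV gh)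
  have pow': "(F' \<psi> ^^ m) (g x) = g ((\<psi> ^^ m) x) \<and> (\<psi> ^^ m) x \<in> V"
    if "\<psi> \<in> rooted_maps V (h r)" "x \<in> V" for \<psi> m x
    using rooted_mapsD[OF that(1)] that(2) by (induction m) (auto simp: F'_def hg)
  show ?thesis
  proof (rule sum.reindex_bij_witness[of _ F' F])
    fix \<phi> assume \<phi>: "\<phi> \<in> rooted_maps I r"
    note D = rooted_mapsD[OF \<phi>]
    show "F' (F \<phi>) = \<phi>"
      using D by (intro extensionalityI[of _ I]) (auto simp: F_def F'_def hV gh)
    show "F \<phi> \<in> rooted_maps V (h r)"
      unfolding rooted_maps_def
    proof (intro CollectI conjI ballI)
      show "F \<phi> \<in> V \<rightarrow>\<^sub>E V" using D hg hV by (auto simp: F_def)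
      show "F \<phi> (h r) = h r" using D r by (simp add: F_def hV gh)
      fix x assume x: "x \<in> V"
      then obtain m where "(\<phi> ^^ m) (g x) = r" using D(3) hg by blast
      then show "\<exists>m. (F \<phi> ^^ m) x = h r" using pow[OF \<phi>, of "g x" m] hg x by auto
    qed
    have "(\<Prod>i\<in>I - {r}. a (h i) (h (\<phi> i))) = (\<Prod>x\<in>V - {h r}. a x (F \<phi> x))"
      by (rule prod.reindex_bij_witness[of _ g h])
        (use r in \<open>auto simp: F_def hV gh hg, (metis gh hg)+\<close>)
    then show "(\<Prod>x\<in>V - {h r}. a x (F \<phi> x)) = (\<Prod>i\<in>I - {r}. a (h i) (h (\<phi> i)))" by simp
  next
    fix \<psi> assume \<psi>: "\<psi> \<in> rooted_maps V (h r)"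
    note D = rooted_mapsD[OF \<psi>]
    show "F (F' \<psi>) = \<psi>"
      using D by (intro extensionalityI[of _ V]) (auto simp: F_def F'_def hg)
    show "F' \<psi> \<in> rooted_maps I r"
      unfolding rooted_maps_def
    proof (intro CollectI conjI ballI)
      show "F' \<psi> \<in> I \<rightarrow>\<^sub>E I" using D hg hV by (auto simp: F'_def)
      show "F' \<psi> r = r" using D r by (simp add: F'_def gh)
      fix i assume i: "i \<in> I"
      then obtain m where "(\<psi> ^^ m) (h i) = h r" using D(3) hV by blast
      then show "\<exists>m. (F' \<psi> ^^ m) i = r"
        using pow'[OF \<psi>, of "h i" m] hV gh i r by auto
    qed
  qed
qed

section \<open>The tree of a rooted map\<close>

text \<open>Both orientations are taken because undirected trees are encoded as symmetric digraphs.
  The root contributes no arc, as \<open>\<phi> r = r\<close> would give a loop.\<close>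

definition parent_tree :: "'a set \<Rightarrow> 'a \<Rightarrow> ('a \<Rightarrow> 'a) \<Rightarrow> 'a pair_pre_digraph" where
  "parent_tree V r \<phi> = \<lparr>pverts = V,
     parcs = (\<lambda>x. (x, \<phi> x)) ` (V - {r}) \<union> (\<lambda>x. (\<phi> x, x)) ` (V - {r})\<rparr>"

lemma pverts_parent_tree [simp]: "pverts (parent_tree V r \<phi>) = V"
  by (simp add: parent_tree_def)

lemma parcs_parent_tree_iff:
  "(x, y) \<in> parcs (parent_tree V r \<phi>) \<longleftrightarrow>
     x \<in> V - {r} \<and> y = \<phi> x \<or> y \<in> V - {r} \<and> x = \<phi> y"
  by (auto simp: parent_tree_def)

lemma pair_graph_parent_tree:
  assumes "finite V" and \<phi>: "\<phi> \<in> rooted_maps V r"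
  shows "pair_graph (parent_tree V r \<phi>)"
proof
  let ?T = "parent_tree V r \<phi>"
  note D = rooted_mapsD[OF \<phi>]
  show "fst e \<in> pverts ?T" "snd e \<in> pverts ?T" if "e \<in> parcs ?T" for e
    using that D by (auto simp: parent_tree_def)
  show "finite (pverts ?T)" "finite (parcs ?T)"
    using assms(1) by (auto simp: parent_tree_def)
  show "fst e \<noteq> snd e" if "e \<in> parcs ?T" for e
    using that rooted_maps_no_swap(1)[OF \<phi>] by (force simp: parent_tree_def)
  show "symmetric (with_proj ?T)"
    by (auto simp: symmetric_def sym_def parcs_parent_tree_iff)
qed

lemma connected_parent_tree:
  assumes "finite V" and \<phi>: "\<phi> \<in> rooted_maps V r" and r: "r \<in> V"
  shows "Digraph_Component.connected (with_proj (parent_tree V r \<phi>))"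
proof -
  let ?T = "parent_tree V r \<phi>"
  interpret T: pair_graph ?T by (rule pair_graph_parent_tree) fact+
  note D = rooted_mapsD[OF \<phi>]
  have to_root: "x \<rightarrow>\<^sup>*\<^bsub>with_proj ?T\<^esub> r" if "(\<phi> ^^ m) x = r" "x \<in> V" for m x
    using that
  proof (induction m arbitrary: x)
    case 0
    then show ?case using r by simp
  next
    case (Suc m)
    show ?case
    proof (cases "x = r")
      case False
      then have "(x, \<phi> x) \<in> parcs ?T" using Suc.prems by (simp add: parcs_parent_tree_iff)
      moreover have "\<phi> x \<rightarrow>\<^sup>*\<^bsub>with_proj ?T\<^esub> r"
        using Suc D(1) by (simp add: funpow_swap1)
      ultimately show ?thesis by (metis T.adj_reachable_trans with_proj_simps(3))
    qed (use r in simp)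
  qed
  then have root: "x \<rightarrow>\<^sup>*\<^bsub>with_proj ?T\<^esub> r" if "x \<in> V" for x using that D(3) by blast
  have "r \<rightarrow>\<^sup>*\<^bsub>with_proj ?T\<^esub> x" if "x \<in> V" for x
    using root[OF that] by (rule T.symmetric_reachable')
  with root have "strongly_connected (with_proj ?T)"
    using r by (intro strongly_connectedI) (auto intro: T.reachable_trans)
  moreover have "(parcs ?T)\<^sup>s = parcs ?T"
    by (auto simp: symcl_def parent_tree_def)
  ultimately show ?thesis
    by (simp add: connected_conv strongly_connected_def reachable_def)
qed

lemma pcas_crossing:
  assumes "pcas u p v" "u \<in> S" "v \<notin> S"
  shows "\<exists>x y. (x, y) \<in> set p \<and> x \<in> S \<and> y \<notin> S"
  using assms
proof (induction p arbitrary: u)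
  case (Cons e p)
  show ?case
  proof (cases "snd e \<in> S")
    case True
    then obtain x y where "(x, y) \<in> set p \<and> x \<in> S \<and> y \<notin> S"
      using Cons.IH[of "snd e"] Cons.prems by auto
    then show ?thesis by auto
  next
    case False
    then show ?thesis using Cons.prems by (intro exI[of _ "fst e"] exI[of _ "snd e"]) auto
  qed
qed auto

text \<open>A simple path does not return to \<open>u\<close> after its first arc, so
  \<open>(u, v)\<close> is that arc; the path is then at its end \<open>v\<close> and cannot
  continue.\<close>

lemma (in pair_wf_digraph) apath_through_ends:
  assumes "apath u p v" "(u, v) \<in> set p"
  shows "p = [(u, v)]"
proof (cases p)
  case (Cons e q)
  with assms have q: "fst e = u" "apath (snd e) q v" "u \<notin> set (pawalk_verts (snd e) q)"
    by (auto simp: apath_Cons_iff)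
  have "(u, v) \<notin> set q"
    using q(3) awalk_verts_arc1[of "(u, v)" q "snd e"] by auto
  with assms Cons have "e = (u, v)" by auto
  moreover from this q have "q = []" using apath_nonempty_ends[of v q v] by auto
  ultimately show ?thesis using Cons by simp
qed (use assms in simp)

text \<open>A cycle through the edge between \<open>x\<close> and \<open>\<phi> x\<close> has to leave the set of descendants of \<open>x\<close>
  a second time, but this edge is the only one leaving that set.\<close>

lemma parent_tree_acyclic:
  assumes "finite V" and \<phi>: "\<phi> \<in> rooted_maps V r"
    and cyc: "pre_digraph.cycle (with_proj (parent_tree V r \<phi>)) p"
  shows "length p < 3"
proof -
  let ?T = "parent_tree V r \<phi>"
  interpret T: pair_graph ?T by (rule pair_graph_parent_tree) fact+
  note D = rooted_mapsD[OF \<phi>]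
  obtain u where u: "T.awalk u p u" "distinct (tl (pawalk_verts u p))" "p \<noteq> []"
    using cyc by (auto simp: T.cycle_def)
  then obtain v q where p: "p = (u, v) # q"
    by (cases p) (auto simp: T.awalk_Cons_iff)
  have uv: "(u, v) \<in> parcs ?T" and q: "T.apath v q u" "T.awalk v q u"
    using u p by (auto simp: T.awalk_Cons_iff T.apath_def)
  have q_arcs: "set q \<subseteq> parcs ?T" and "pcas v q u" using q(2) by (auto simp: T.awalk_def)
  define desc where "desc x = {y. \<exists>m. (\<phi> ^^ m) y = x}" for x
  have desc_self: "x \<in> desc x" for x unfolding desc_def by (auto intro: exI[of _ 0])
  have desc_step: "y \<in> desc x" if "\<phi> y \<in> desc x" for x y
  proof -
    obtain m where "(\<phi> ^^ m) (\<phi> y) = x" using \<open>\<phi> y \<in> desc x\<close> by (auto simp: desc_def)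
    then have "(\<phi> ^^ Suc m) y = x" by (simp add: funpow_swap1)
    then show ?thesis unfolding desc_def by blast
  qed
  have desc_parent: "\<phi> y \<in> desc x" if y: "y \<in> desc x" "y \<noteq> x" for x y
  proof -
    obtain m where "(\<phi> ^^ m) y = x" using y(1) by (auto simp: desc_def)
    with y(2) obtain k where "(\<phi> ^^ Suc k) y = x" by (cases m) auto
    then show ?thesis by (auto simp: desc_def funpow_swap1)
  qed
  have parent_not_desc: "\<phi> x \<notin> desc x" if "x \<in> V - {r}" for x
  proof
    assume "\<phi> x \<in> desc x"
    then obtain m where "(\<phi> ^^ Suc m) x = x" by (auto simp: desc_def funpow_swap1)
    then show False using rooted_maps_periodic[OF \<phi>, of x "Suc m"] that by auto
  qed
  have "(v, u) \<in> set q"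
  proof -
    consider "u \<in> V - {r}" "v = \<phi> u" | "v \<in> V - {r}" "u = \<phi> v"
      using uv by (auto simp: parcs_parent_tree_iff)
    then show ?thesis
    proof cases
      \<comment> \<open>The return path \<open>q\<close> starts outside \<open>desc u\<close> and
        ends at \<open>u\<close>, so some arc enters this set; \<open>desc_step\<close> and
        \<open>desc_parent\<close> leave only the arc from \<open>\<phi> u\<close> to
        \<open>u\<close>. The other case is the mirror image.\<close>
      case 1
      then obtain x y where xy: "(x, y) \<in> set q" "x \<notin> desc u" "y \<in> desc u"
        using pcas_crossing[OF \<open>pcas v q u\<close>, of "- desc u"] parent_not_desc desc_self by auto
      from xy(1) q_arcs have "y = \<phi> x \<or> x = \<phi> y" by (auto simp: parcs_parent_tree_iff)
      with xy desc_step have "x = \<phi> y" by blast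
      with xy desc_parent have "y = u" by blast
      with \<open>x = \<phi> y\<close> 1 xy show ?thesis by simp
    next
      case 2
      then obtain x y where xy: "(x, y) \<in> set q" "x \<in> desc v" "y \<notin> desc v"
        using pcas_crossing[OF \<open>pcas v q u\<close>, of "desc v"] parent_not_desc desc_self by auto
      from xy(1) q_arcs have "y = \<phi> x \<or> x = \<phi> y" by (auto simp: parcs_parent_tree_iff)
      with xy desc_step have "y = \<phi> x" by blast
      with xy desc_parent have "x = v" by blast
      with \<open>y = \<phi> x\<close> 2 xy show ?thesis by simp
    qed
  qed
  \<comment> \<open>The cycle merely traverses one edge back and forth.\<close>
  then have "q = [(v, u)]" using q(1) by (rule T.apath_through_ends[rotated])
  then show ?thesis using p by simp
qed

lemma undirected_tree_parent_tree:
  assumes "finite V" "\<phi> \<in> rooted_maps V r" "r \<in> V"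
  shows "undirected_tree (parent_tree V r \<phi>)"
  unfolding undirected_tree_def
  using pair_graph_parent_tree[OF assms(1,2)] connected_parent_tree[OF assms]
    parent_tree_acyclic[OF assms(1,2)] by (auto simp: not_le)

section \<open>The bijection between rooted maps and spanning trees\<close>

text \<open>If the maps disagree at \<open>x\<close>, the arc \<open>(x, \<phi> x)\<close> can lie
  in the tree of \<open>\<psi>\<close> only as \<open>\<psi> (\<phi> x) = x\<close>. This differs
  from \<open>\<phi> (\<phi> x)\<close>, so the disagreement moves up along \<open>\<phi>\<close>
  forever and the root is never reached.\<close>

lemma inj_on_parent_tree:
  "inj_on (parent_tree V r) (rooted_maps V r)"
proof (rule inj_onI)
  fix \<phi> \<psi> assume \<phi>: "\<phi> \<in> rooted_maps V r" and \<psi>: "\<psi> \<in> rooted_maps V r"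
    and eq: "parent_tree V r \<phi> = parent_tree V r \<psi>"
  note D = rooted_mapsD[OF \<phi>] and D' = rooted_mapsD[OF \<psi>]
  have disagree: "\<phi> x \<in> V - {r} \<and> \<phi> (\<phi> x) \<noteq> \<psi> (\<phi> x)" if x: "x \<in> V - {r}" "\<phi> x \<noteq> \<psi> x" for x
  proof -
    have "(x, \<phi> x) \<in> parcs (parent_tree V r \<psi>)"
      unfolding eq[symmetric] using x by (simp add: parcs_parent_tree_iff)
    with x have "\<phi> x \<in> V - {r}" "\<psi> (\<phi> x) = x" by (auto simp: parcs_parent_tree_iff)
    moreover have "\<phi> (\<phi> x) \<noteq> x" using rooted_maps_no_swap(2)[OF \<phi>] x by auto
    ultimately show ?thesis by simp
  qed
  show "\<phi> = \<psi>"
  proof (rule extensionalityI[OF D(4) D'(4)])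
    fix x assume x: "x \<in> V"
    show "\<phi> x = \<psi> x"
    proof (rule ccontr)
      assume ne: "\<phi> x \<noteq> \<psi> x"
      then have "x \<noteq> r" using D(2) D'(2) by auto
      then have "(\<phi> ^^ m) x \<in> V - {r} \<and> \<phi> ((\<phi> ^^ m) x) \<noteq> \<psi> ((\<phi> ^^ m) x)" for m
        using x ne disagree by (induction m) auto
      then show False using D(3)[OF x] by blast
    qed
  qed
qed

text \<open>Parents are chosen among the neighbours closer to \<open>r\<close>, so
  \<open>\<phi>\<close> is rooted and its tree lies in \<open>T\<close>. A further arc of
  \<open>T\<close> would close a path of that tree to a cycle of length at least 3.\<close>

lemma undirected_tree_imp_parent_tree:
  assumes T: "undirected_tree T" and r: "r \<in> pverts T"
  shows "\<exists>\<phi>\<in>rooted_maps (pverts T) r. parent_tree (pverts T) r \<phi> = T"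
proof -
  interpret T: pair_graph T using T by (simp add: undirected_tree_def)
  have acyc: "\<not> (T.cycle p \<and> 3 \<le> length p)" for p
    using T by (auto simp: undirected_tree_def)
  have "strongly_connected (with_proj T)"
    using T T.symmetric_connected_imp_strongly_connected[OF T.sym_arcs]
    by (simp add: undirected_tree_def)
  then have ex_walk: "\<exists>p. T.awalk x p r" if "x \<in> pverts T" for x
    using that r T.reachable_awalk by (auto simp: strongly_connected_def)
  \<comment> \<open>The distance to \<open>r\<close>: the first arc of a shortest walk leads to a
    vertex with a smaller value.\<close>
  define d where "d x = (LEAST k. \<exists>p. T.awalk x p r \<and> length p = k)" for x
  have ex_parent: "\<exists>y. (x, y) \<in> parcs T \<and> d y < d x" if x: "x \<in> pverts T" "x \<noteq> r" for x
  proof -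
    have "\<exists>p. T.awalk x p r \<and> length p = d x"
      unfolding d_def using ex_walk[OF x(1)] 
      by (intro LeastI_ex[of "\<lambda>k. \<exists>p. T.awalk x p r \<and> length p = k"]) blast
    then obtain p where p: "T.awalk x p r" "length p = d x" by blast
    with x obtain y q where "p = (x, y) # q"
      by (cases p) (auto simp: T.awalk_Nil_iff T.awalk_Cons_iff)
    with p have "(x, y) \<in> parcs T" "T.awalk y q r" "d x = Suc (length q)"
      by (auto simp: T.awalk_Cons_iff)
    moreover have "d y \<le> length q"
      unfolding d_def using \<open>T.awalk y q r\<close> by (intro Least_le exI[of _ q]) simp
    ultimately show ?thesis by (intro exI[of _ y]) simp
  qed
  define \<phi> where
    "\<phi> = (\<lambda>x\<in>pverts T. if x = r then r else SOME y. (x, y) \<in> parcs T \<and> d y < d x)"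
  have \<phi>: "(x, \<phi> x) \<in> parcs T \<and> d (\<phi> x) < d x" if "x \<in> pverts T - {r}" for x
    using someI_ex[OF ex_parent, of x] that by (auto simp: \<phi>_def)
  have \<phi>r: "\<phi> r = r" using r by (simp add: \<phi>_def)
  have \<phi>V: "\<phi> x \<in> pverts T" if "x \<in> pverts T" for x
    using \<phi>[of x] \<phi>r r that T.in_arcsD2 by (cases "x = r") auto
  have reach: "\<exists>m. (\<phi> ^^ m) x = r" if "x \<in> pverts T" for x
    using that
  proof (induction "d x" arbitrary: x rule: less_induct)
    case less
    show ?case
    proof (cases "x = r")
      case True
      then show ?thesis by (intro exI[of _ 0]) simp
    next
      case False
      then obtain m where "(\<phi> ^^ m) (\<phi> x) = r" using less \<phi> \<phi>V by blast
      then have "(\<phi> ^^ Suc m) x = r" by (simp add: funpow_swap1)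
      then show ?thesis by blast
    qed
  qed
  have rooted: "\<phi> \<in> rooted_maps (pverts T) r"
    using \<phi>V \<phi>r reach by (auto simp: rooted_maps_def) (simp add: \<phi>_def)
  let ?P = "parent_tree (pverts T) r \<phi>"
  interpret P: pair_graph ?P by (rule pair_graph_parent_tree[OF T.pair_finite_verts rooted])
  have sub: "parcs ?P \<subseteq> parcs T"
    using \<phi> T.arcs_symmetric by (auto simp: parent_tree_def)
  have P_sc: "strongly_connected (with_proj ?P)"
    using P.symmetric_connected_imp_strongly_connected[OF P.sym_arcs]
      connected_parent_tree[OF T.pair_finite_verts rooted r] by blast
  have "parcs T \<subseteq> parcs ?P"
  proof (rule ccontr)
    assume "\<not> ?thesis"
    then obtain a b where ab: "(a, b) \<in> parcs T" "(a, b) \<notin> parcs ?P" by auto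
    then have ba: "(b, a) \<notin> parcs ?P" using P.arcs_symmetric by blast
    have V: "a \<in> pverts T" "b \<in> pverts T" using ab T.wellformed' by auto
    with P_sc have "b \<rightarrow>\<^sup>*\<^bsub>with_proj ?P\<^esub> a" by (auto simp: strongly_connected_def)
    then obtain q where q: "P.apath b q a" using P.reachable_apath by blast
    then have q': "pcas b q a" "set q \<subseteq> parcs ?P" "distinct (pawalk_verts b q)"
      by (auto simp: P.apath_def P.awalk_def)
    have "T.awalk a ((a, b) # q) a"
      using ab V q' sub by (auto simp: T.awalk_def)
    then have "T.cycle ((a, b) # q)"
      using q'(3) unfolding T.cycle_def by (intro exI[of _ a]) simp
    moreover have "a \<noteq> b" using ab T.no_loops' by blast
    \<comment> \<open>\<open>q\<close> is nonempty since \<open>a \<noteq> b\<close>, and not a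
      single arc since \<open>(b, a)\<close> is missing from \<open>?P\<close> too.\<close>
    then have "length q \<ge> 2"
      using q'(1,2) ba by (cases q; cases "tl q") auto
    ultimately show False using acyc[of "(a, b) # q"] by simp
  qed
  with sub have "?P = T" by (auto intro!: pair_pre_digraph.equality)
  with rooted show ?thesis by blast
qed

lemma bij_betw_parent_tree_spanning_trees:
  assumes G: "pair_graph G" and r: "r \<in> pverts G"
  shows "bij_betw (parent_tree (pverts G) r)
     {\<phi> \<in> rooted_maps (pverts G) r. \<forall>x\<in>pverts G - {r}. (x, \<phi> x) \<in> parcs G} (spanning_trees G)"
proof -
  interpret G: pair_graph G by fact
  let ?R = "{\<phi> \<in> rooted_maps (pverts G) r. \<forall>x\<in>pverts G - {r}. (x, \<phi> x) \<in> parcs G}"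
  have "parent_tree (pverts G) r \<phi> \<in> spanning_trees G" if \<phi>: "\<phi> \<in> ?R" for \<phi>
  proof -
    let ?T = "parent_tree (pverts G) r \<phi>"
    have tree: "undirected_tree ?T"
      using \<phi> r undirected_tree_parent_tree[OF G.pair_finite_verts] by blast
    then interpret T: pair_graph ?T by (simp add: undirected_tree_def)
    have "parcs ?T \<subseteq> parcs G"
      using \<phi> G.arcs_symmetric by (auto simp: parent_tree_def)
    then have "spanning (with_proj ?T) (with_proj G)"
      by (auto simp: spanning_def subgraph_def G.wf_digraph T.wf_digraph)
    with tree show ?thesis by (simp add: spanning_trees_def)
  qed
  moreover have "T \<in> parent_tree (pverts G) r ` ?R" if T: "T \<in> spanning_trees G" for T
  proof -
    have T': "undirected_tree T" "pverts T = pverts G" "parcs T \<subseteq> parcs G"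
      using T by (auto simp: spanning_trees_def spanning_def subgraph_def)
    then obtain \<phi> where \<phi>: "\<phi> \<in> rooted_maps (pverts G) r" "parent_tree (pverts G) r \<phi> = T"
      using undirected_tree_imp_parent_tree[of T r] r by auto
    then have "(x, \<phi> x) \<in> parcs T" if "x \<in> pverts G - {r}" for x
      using that by (auto simp: parcs_parent_tree_iff)
    with \<phi> T'(3) show ?thesis by blast
  qed
  ultimately show ?thesis
    by (auto simp: bij_betw_def intro: inj_on_subset[OF inj_on_parent_tree])
qed

section \<open>Weights of trees, edges and vertices\<close>

text \<open>Each vertex except the root owns the edge to its parent; two vertices owning the same
  edge would be parents of each other.\<close>

lemma prod_edges_of_parent_tree:
  assumes \<phi>: "\<phi> \<in> rooted_maps V r"
  shows "(\<Prod>e\<in>edges_of (parent_tree V r \<phi>). c e) = (\<Prod>x\<in>V - {r}. c {x, \<phi> x})"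
proof -
  have "edges_of (parent_tree V r \<phi>) = (\<lambda>x. {x, \<phi> x}) ` (V - {r})"
    by (auto simp: edges_of_def parent_tree_def image_Un image_image insert_commute)
  moreover have "inj_on (\<lambda>x. {x, \<phi> x}) (V - {r})"
  proof (rule inj_onI)
    fix x y assume "x \<in> V - {r}" "y \<in> V - {r}" "{x, \<phi> x} = {y, \<phi> y}"
    then show "x = y"
      using rooted_maps_no_swap(2)[OF \<phi>, of y] by (auto simp: doubleton_eq_iff)
  qed
  ultimately show ?thesis by (simp add: prod.reindex)
qed

text \<open>The weighted matrix indexed by vertices; the value 0 off the arcs lets sums range over
  all pairs of vertices.\<close>

definition arc_weight :: "'a pair_pre_digraph \<Rightarrow> ('a \<times> 'a \<Rightarrow> complex) \<Rightarrow> 'a \<Rightarrow> 'a \<Rightarrow> complex" where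
  "arc_weight G w x y = (if (x, y) \<in> parcs G then w (x, y) else 0)"

text \<open>Spanning trees correspond to the rooted maps along arcs of \<open>G\<close>; every other
  rooted map has a factor 0 and may be added to the sum.\<close>

lemma weighted_complexity_eq_sum_rooted_maps:
  assumes G: "pair_graph G" and r: "r \<in> pverts G" and w: "symmetric_weight G w"
  shows "weighted_complexity G w =
     (\<Sum>\<phi>\<in>rooted_maps (pverts G) r. \<Prod>x\<in>pverts G - {r}. arc_weight G w x (\<phi> x))"
proof -
  interpret G: pair_graph G by fact
  let ?V = "pverts G"
  let ?R = "{\<phi> \<in> rooted_maps ?V r. \<forall>x\<in>?V - {r}. (x, \<phi> x) \<in> parcs G}"
  have "weighted_complexity G w =
      (\<Sum>\<phi>\<in>?R. \<Prod>e\<in>edges_of (parent_tree ?V r \<phi>). edge_weight G w e)"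
    unfolding weighted_complexity_def
    by (rule sum.reindex_bij_betw[symmetric, OF bij_betw_parent_tree_spanning_trees[OF G r]])
  also have "\<dots> = (\<Sum>\<phi>\<in>?R. \<Prod>x\<in>?V - {r}. arc_weight G w x (\<phi> x))"
    by (auto intro!: sum.cong prod.cong simp: prod_edges_of_parent_tree edge_weight_eq[OF w]
        arc_weight_def)
  also have "\<dots> = (\<Sum>\<phi>\<in>rooted_maps ?V r. \<Prod>x\<in>?V - {r}. arc_weight G w x (\<phi> x))"
  proof (rule sum.mono_neutral_left)
    show "finite (rooted_maps ?V r)"
      by (rule finite_subset[of _ "?V \<rightarrow>\<^sub>E ?V"])
        (auto simp: rooted_maps_def intro: finite_PiE)
    show "\<forall>\<phi>\<in>rooted_maps ?V r - ?R. (\<Prod>x\<in>?V - {r}. arc_weight G w x (\<phi> x)) = 0"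
    proof
      fix \<phi> assume "\<phi> \<in> rooted_maps ?V r - ?R"
      then obtain x where "x \<in> ?V - {r}" "(x, \<phi> x) \<notin> parcs G" by blast
      then show "(\<Prod>x\<in>?V - {r}. arc_weight G w x (\<phi> x)) = 0"
        by (intro prod_zero) (auto simp: arc_weight_def)
    qed
  qed blast
  finally show ?thesis .
qed

text \<open>Handshake argument: when arcs are grouped by their edge, each group consists of two
  distinct arcs of equal weight.\<close>

lemma sum_arc_weight:
  assumes G: "pair_graph G" and w: "symmetric_weight G w"
  shows "(\<Sum>x\<in>pverts G. \<Sum>y\<in>pverts G. arc_weight G w x y) = 2 * total_weight G w"
proof -
  interpret G: pair_graph G by fact
  have "(\<Sum>x\<in>pverts G. \<Sum>y\<in>pverts G. arc_weight G w x y) =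
      (\<Sum>e\<in>pverts G \<times> pverts G. if e \<in> parcs G then w e else 0)"
    unfolding sum.cartesian_product by (rule sum.cong) (auto simp: arc_weight_def)
  also have "\<dots> = (\<Sum>e\<in>parcs G. w e)"
    by (rule sum.mono_neutral_cong_right) (auto dest: G.wellformed')
  also have "\<dots> = (\<Sum>E\<in>edges_of G. \<Sum>e\<in>{e \<in> parcs G. (\<lambda>(u, v). {u, v}) e = E}. w e)"
    unfolding edges_of_def by (rule sum.image_gen[OF G.pair_finite_arcs])
  also have "\<dots> = (\<Sum>E\<in>edges_of G. 2 * edge_weight G w E)"
  proof (rule sum.cong[OF refl])
    fix E assume "E \<in> edges_of G"
    then obtain u v where uv: "(u, v) \<in> parcs G" "E = {u, v}" by (auto simp: edges_of_def)
    then have "{e \<in> parcs G. (\<lambda>(u, v). {u, v}) e = E} = {(u, v), (v, u)}"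
      using G.arcs_symmetric by (auto simp: doubleton_eq_iff)
    moreover have "u \<noteq> v" using uv G.no_loops' by blast
    moreover have "w (v, u) = w (u, v)" using w uv by (auto simp: symmetric_weight_def)
    ultimately show "(\<Sum>e\<in>{e \<in> parcs G. (\<lambda>(u, v). {u, v}) e = E}. w e) = 2 * edge_weight G w E"
      using uv by (simp add: edge_weight_eq[OF w])
  qed
  finally show ?thesis by (simp add: total_weight_def sum_distrib_left)
qed

lemma sum_out_arcs:
  assumes G: "pair_graph G"
  shows "(\<Sum>e\<in>out_arcs (with_proj G) x. w e) = (\<Sum>y\<in>pverts G. arc_weight G w x y)"
proof -
  interpret G: pair_graph G by fact
  have "(\<Sum>e\<in>out_arcs (with_proj G) x. w e) = (\<Sum>y\<in>{y. (x, y) \<in> parcs G}. w (x, y))"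
    by (rule sum.reindex_bij_witness[of _ "\<lambda>y. (x, y)" snd]) (auto simp: out_arcs_def)
  also have "\<dots> = (\<Sum>y\<in>pverts G. arc_weight G w x y)"
    by (rule sum.mono_neutral_cong_left) (auto simp: arc_weight_def dest: G.wellformed')
  finally show ?thesis .
qed

section \<open>The derivatives\<close>

lemma bij_betw_nth_atLeast0LessThan:
  "distinct xs \<Longrightarrow> bij_betw ((!) xs) {0..<length xs} (set xs)"
  by (rule bij_betw_nth) auto

text \<open>The matrix-tree theorem for \<open>G\<close>. The factor \<open>t\<close> is absorbed
  into the coefficients, and each rooted map picks it up once for every row other than
  \<open>k\<close>.\<close>

lemma det_scaled_laplacian_rooted:
  fixes a :: "nat \<Rightarrow> nat \<Rightarrow> complex"
  assumes G: "pair_graph G" and vs: "distinct vs" "set vs = pverts G"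
    and w: "symmetric_weight G w" and k: "k < length vs"
    and a: "\<And>i j. a i j = arc_weight G w (vs ! i) (vs ! j)"
  shows "det (mat (length vs) (length vs) (\<lambda>(i, l). if i = k then of_bool (l = k)
       else t * (of_bool (l = i) * (\<Sum>j\<in>{0..<length vs}. a i j) - a i l))) =
     t ^ (length vs - 1) * weighted_complexity G w"
proof -
  let ?n = "length vs"
  have "det (mat ?n ?n (\<lambda>(i, l). if i = k then of_bool (l = k)
       else t * (of_bool (l = i) * (\<Sum>j\<in>{0..<?n}. a i j) - a i l))) =
     det (mat ?n ?n (\<lambda>(i, l). if i = k then of_bool (l = k)
       else of_bool (l = i) * (\<Sum>j\<in>{0..<?n}. t * a i j) - t * a i l))"
    by (rule arg_cong[of _ _ det], rule eq_matI)
      (auto simp: sum_distrib_left right_diff_distrib)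
  also have "\<dots> = (\<Sum>\<phi>\<in>rooted_maps {0..<?n} k. \<Prod>i\<in>{0..<?n} - {k}. t * a i (\<phi> i))"
    by (rule det_laplacian_rooted[OF k])
  also have "\<dots> = t ^ (?n - 1) * (\<Sum>\<phi>\<in>rooted_maps {0..<?n} k. \<Prod>i\<in>{0..<?n} - {k}.
      arc_weight G w (vs ! i) (vs ! \<phi> i))"
    using k by (simp add: prod.distrib sum_distrib_left a)
  also have "(\<Sum>\<phi>\<in>rooted_maps {0..<?n} k. \<Prod>i\<in>{0..<?n} - {k}.
      arc_weight G w (vs ! i) (vs ! \<phi> i)) = weighted_complexity G w"
    using sum_rooted_maps_reindex[OF bij_betw_nth_atLeast0LessThan[OF vs(1)], of k "arc_weight G w"]
      weighted_complexity_eq_sum_rooted_maps[OF G _ w, of "vs ! k"] vs(2) k nth_mem[OF k] by simp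
  finally show ?thesis .
qed

text \<open>The derivative depends only on the sum of the entries of the differentiated matrix, because
  the adjugate of the Laplacian is a multiple of the all-ones matrix.\<close>

lemma has_field_derivative_det_at_scaled_laplacian:
  fixes a :: "nat \<Rightarrow> nat \<Rightarrow> complex"
  assumes G: "pair_graph G" and vs: "distinct vs" "set vs = pverts G" "length vs = n"
    and w: "symmetric_weight G w"
    and a: "\<And>i j. a i j = arc_weight G w (vs ! i) (vs ! j)"
    and A: "\<And>i j. i < n \<Longrightarrow> j < n \<Longrightarrow> ((\<lambda>s. A s i j) has_field_derivative A' i j) (at z)"
    and Az: "\<And>i l. i < n \<Longrightarrow> l < n \<Longrightarrow>
      A z i l = t * (of_bool (l = i) * (\<Sum>j\<in>{0..<n}. a i j) - a i l)"
  shows "((\<lambda>s. det (mat n n (\<lambda>(i, j). A s i j))) has_field_derivative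
     (\<Sum>i\<in>{0..<n}. \<Sum>j\<in>{0..<n}. A' i j) * (t ^ (n - 1) * weighted_complexity G w)) (at z)"
proof -
  let ?L = "\<lambda>i l. t * (of_bool (l = i) * (\<Sum>j\<in>{0..<n}. a i j) - a i l)"
  have "det (mat n n (\<lambda>(i, j). if i = k then A' i j else A z i j)) =
      (\<Sum>j\<in>{0..<n}. A' k j) * (t ^ (n - 1) * weighted_complexity G w)" if k: "k < n" for k
  proof -
    have "mat n n (\<lambda>(i, j). if i = k then A' i j else A z i j) =
        mat n n (\<lambda>(i, j). if i = k then A' k j else ?L i j)"
      by (rule eq_matI) (auto simp: Az)
    then have "det (mat n n (\<lambda>(i, j). if i = k then A' i j else A z i j)) =
        det (mat n n (\<lambda>(i, j). if i = k then A' k j else ?L i j))"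
      by (rule arg_cong)
    also have "\<dots> = (\<Sum>j\<in>{0..<n}. A' k j) *
        det (mat n n (\<lambda>(i, j). if i = k then of_bool (j = k) else ?L i j))"
    proof (rule det_mat_replace_row_zero_row_sums[OF k])
      fix i assume "i < n"
      have "(\<Sum>l\<in>{0..<n}. of_bool (l = i) * (\<Sum>j\<in>{0..<n}. a i j)) = (\<Sum>j\<in>{0..<n}. a i j)"
        using \<open>i < n\<close> by (simp add: sum_distrib_right[symmetric] of_bool_def sum.delta)
      then show "(\<Sum>l\<in>{0..<n}. ?L i l) = 0"
        by (simp add: sum_distrib_left[symmetric] sum_subtractf)
    qed
    also have "det (mat n n (\<lambda>(i, j). if i = k then of_bool (j = k) else ?L i j)) =
        t ^ (n - 1) * weighted_complexity G w"
      using det_scaled_laplacian_rooted[OF G vs(1,2) w _ a, of k t] k unfolding vs(3) by simp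
    finally show ?thesis .
  qed
  then show ?thesis
    using has_field_derivative_det_mat[of n A A' z, OF A]
    by (simp add: sum_distrib_right)
qed

theorem theorem11:
  fixes G :: "'a pair_pre_digraph" and vs :: "'a list" and n :: nat
    and w :: "'a \<times> 'a \<Rightarrow> complex" and t :: complex
  assumes "pair_graph G"
    and "Digraph_Component.connected (with_proj G)"
    and "distinct vs" and "set vs = pverts G" and "length vs = n"
    and "symmetric_weight G w"
    and "t \<noteq> 0"
  shows "((\<lambda>s. f_w G vs w (1 - 1 / t) s) has_field_derivative
            2 * t powi (int n - 2) * (total_weight G w * t - of_nat n) * weighted_complexity G w) (at t)
       \<and> ((\<lambda>u. f_w G vs w u t) has_field_derivative
            - 2 * t ^ n * (total_weight G w * t - of_nat n) * weighted_complexity G w) (at (1 - 1 / t))"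
proof -
  note G = assms(1) and vs = assms(3-5) and w = assms(6) and t = assms(7)
  define a where "a i j = arc_weight G w (vs ! i) (vs ! j)" for i j
  define D where "D i = (\<Sum>j\<in>{0..<n}. a i j)" for i
  define \<tau> where "\<tau> = total_weight G w"
  define \<kappa> where "\<kappa> = weighted_complexity G w"
  \<comment> \<open>\<open>b\<close> stands for \<open>1 - u\<close>, so that one matrix serves both
    derivatives.\<close>
  define M where "M b s i l = of_bool (l = i) - s * a i l + b * s\<^sup>2 * (of_bool (l = i) * (D i - b))"
    for b s :: complex and i l
  note deriv = has_field_derivative_det_at_scaled_laplacian[OF G vs w a_def, folded D_def \<kappa>_def]
  have bij: "bij_betw ((!) vs) {0..<n} (pverts G)"
    using bij_betw_nth_atLeast0LessThan[of vs] vs by simp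
  have sum_vs: "(\<Sum>j\<in>{0..<n}. g (vs ! j)) = (\<Sum>y\<in>pverts G. g y)" for g :: "'a \<Rightarrow> complex"
    using sum.reindex_bij_betw[OF bij] .
  have D: "D i = (\<Sum>e\<in>out_arcs (with_proj G) (vs ! i). w e)" for i
    by (simp add: D_def a_def sum_vs sum_out_arcs[OF G])
  have "(\<Sum>i\<in>{0..<n}. \<Sum>j\<in>{0..<n}. a i j) = 2 * \<tau>"
    by (simp add: a_def sum_vs[of "\<lambda>x. arc_weight G w _ x"] sum_vs[of "\<lambda>x. \<Sum>y\<in>_. arc_weight G w x y"]
        sum_arc_weight[OF G w] \<tau>_def)
  then have sum_D: "(\<Sum>i\<in>{0..<n}. D i) = 2 * \<tau>" by (simp add: D_def)
  have f: "f_w G vs w u s = det (mat n n (\<lambda>(i, l). M (1 - u) s i l))" for u s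
    unfolding f_w_def
    by (rule arg_cong[of _ _ det], rule eq_matI)
      (auto simp: vs(3) weighted_matrix_def weighted_degree_matrix_def M_def a_def arc_weight_def D)
  \<comment> \<open>At \<open>b = 1 / t\<close> the term \<open>b\<^sup>2 * t\<^sup>2\<close> is 1
    and cancels the identity, while \<open>b * t\<^sup>2\<close> is \<open>t\<close>.\<close>
  have M_t: "M (1 / t) t i l = t * (of_bool (l = i) * D i - a i l)" for i l
    using t by (simp add: M_def field_simps power2_eq_square)
  \<comment> \<open>Both differentiated matrices are a multiple of the weighted matrix plus a
    diagonal part, so this one evaluation covers them.\<close>
  have entry_sum: "(\<Sum>i\<in>{0..<n}. \<Sum>l\<in>{0..<n}. x * a i l + of_bool (l = i) * (y * D i + z)) =
      2 * (x + y) * \<tau> + of_nat n * z" for x y z :: complex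
  proof -
    have "(\<Sum>i\<in>{0..<n}. \<Sum>l\<in>{0..<n}. x * a i l + of_bool (l = i) * (y * D i + z)) =
        (\<Sum>i\<in>{0..<n}. x * D i + (y * D i + z))"
      by (intro sum.cong refl)
        (simp add: sum.distrib sum_distrib_left[symmetric] sum_distrib_right[symmetric]
          D_def[symmetric] of_bool_def sum.delta)
    also have "\<dots> = 2 * (x + y) * \<tau> + of_nat n * z"
      by (simp add: sum.distrib sum_distrib_left[symmetric] sum_D algebra_simps)
    finally show ?thesis .
  qed
  \<comment> \<open>The derivative \<open>2 * b * s * (D i - b)\<close> of the last summand becomes
    \<open>2 * D i - 2 / t\<close> at \<open>s = t\<close> and \<open>b = 1 / t\<close>.\<close>
  have deriv_t: "((\<lambda>s. det (mat n n (\<lambda>(i, l). M (1 / t) s i l))) has_field_derivative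
      (\<Sum>i\<in>{0..<n}. \<Sum>l\<in>{0..<n}. - 1 * a i l + of_bool (l = i) * (2 * D i + - 2 / t)) *
      (t ^ (n - 1) * \<kappa>)) (at t)"
  proof (rule deriv)
    fix i l assume "i < n" "l < n"
    show "((\<lambda>s. M (1 / t) s i l) has_field_derivative
        - 1 * a i l + of_bool (l = i) * (2 * D i + - 2 / t)) (at t)"
      unfolding M_def using t
      by (auto intro!: derivative_eq_intros simp: field_simps)
  qed (simp add: M_t)
  \<comment> \<open>The entries sum to \<open>2 * (\<tau> * t - n) / t\<close>. The division lowers
    the exponent to \<open>n - 2\<close>, which is -1 for a single vertex, hence
    \<open>powi\<close>.\<close>
  have value_t: "(\<Sum>i\<in>{0..<n}. \<Sum>l\<in>{0..<n}. - 1 * a i l + of_bool (l = i) * (2 * D i + - 2 / t)) *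
      (t ^ (n - 1) * \<kappa>) = 2 * t powi (int n - 2) * (\<tau> * t - of_nat n) * \<kappa>"
  proof (cases n)
    case 0
    then show ?thesis using sum_D by simp
  next
    case (Suc m)
    then have "t powi (int n - 2) * t = t powi int m"
      using t power_int_add_1[of t "int n - 2"] by (simp add: algebra_simps)
    then have "t ^ m = t powi (int n - 2) * t" by simp
    then show ?thesis unfolding entry_sum using t Suc by (simp add: field_simps)
  qed
  \<comment> \<open>As \<open>b = 1 - u\<close> has derivative -1, the diagonal term yields
    \<open>- t\<^sup>2 * (D i - 2 * b)\<close>, evaluated at \<open>b = 1 / t\<close>.\<close>
  have deriv_u: "((\<lambda>u. det (mat n n (\<lambda>(i, l). M (1 - u) t i l))) has_field_derivative
      (\<Sum>i\<in>{0..<n}. \<Sum>l\<in>{0..<n}. 0 * a i l + of_bool (l = i) * (- t\<^sup>2 * D i + 2 * t)) *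
      (t ^ (n - 1) * \<kappa>)) (at (1 - 1 / t))"
  proof (rule deriv)
    fix i l assume "i < n" "l < n"
    show "((\<lambda>u. M (1 - u) t i l) has_field_derivative
        0 * a i l + of_bool (l = i) * (- t\<^sup>2 * D i + 2 * t)) (at (1 - 1 / t))"
      unfolding M_def using t
      by (auto intro!: derivative_eq_intros simp: field_simps power2_eq_square)
  qed (simp add: M_t)
  \<comment> \<open>The entries sum to \<open>- 2 * t * (\<tau> * t - n)\<close>, whose factor
    \<open>t\<close> raises the exponent to \<open>n\<close>.\<close>
  have value_u: "(\<Sum>i\<in>{0..<n}. \<Sum>l\<in>{0..<n}. 0 * a i l + of_bool (l = i) * (- t\<^sup>2 * D i + 2 * t)) *
      (t ^ (n - 1) * \<kappa>) = - 2 * t ^ n * (\<tau> * t - of_nat n) * \<kappa>"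
  proof (cases n)
    case 0
    then show ?thesis using sum_D by simp
  next
    case (Suc m)
    then show ?thesis unfolding entry_sum by (simp add: algebra_simps power2_eq_square)
  qed
  show ?thesis
    using deriv_t[unfolded value_t] deriv_u[unfolded value_u]
    by (simp only: f \<tau>_def \<kappa>_def diff_diff_eq2 add_diff_cancel_left')
qed

end
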